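(* Let $a:\mathbb{N}\to\mathbb{R}$ be a function such that $a(G) \geq a(n)$ holds for every simple planar graph $G$ on $n$ vertices. Then every planar multigraph $M$ on $n$ vertices with exactly $k$ pairs of vertices that have parallel edges between them satisfies $a(M) \geq a(n+k)-k$.
   Context: Multigraphs are finite, may have parallel edges, but have no loops. For a (multi)graph $G$, $a(G)$ denotes the maximum number of vertices of an induced forest in $G$ (a $2$-cycle formed by two parallel edges counts as a cycle). The function $a(n)$ depends only on $n$, not on the graph. *)

theory Defs
  imports "HOL-Analysis.Analysis"
begin

record ('v, 'e) multigraph =
  verts :: "'v set"
  edges :: "'e set"
  ends :: "'e \<Rightarrow> 'v set"

definition is_multigraph :: "('v, 'e) multigraph \<Rightarrow> bool" where
  "is_multigraph G \<longleftrightarrow> finite (verts G) \<and> finite (edges G) \<and>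
     (\<forall>e\<in>edges G. ends G e \<subseteq> verts G \<and> card (ends G e) = 2)"

definition is_simple_graph :: "('v, 'e) multigraph \<Rightarrow> bool" where
  "is_simple_graph G \<longleftrightarrow> is_multigraph G \<and> inj_on (ends G) (edges G)"

definition parallel_pairs :: "('v, 'e) multigraph \<Rightarrow> 'v set set" where
  "parallel_pairs G =
     {P. \<exists>e\<in>edges G. \<exists>f\<in>edges G. e \<noteq> f \<and> ends G e = P \<and> ends G f = P}"

(* A topological drawing: vertices are distinct points, every edge is an injective curve joining
   its two ends and meeting no other vertex, and two edges meet only in common ends. *)
definition planar_drawing ::
  "('v, 'e) multigraph \<Rightarrow> ('v \<Rightarrow> real^2) \<Rightarrow> ('e \<Rightarrow> real \<Rightarrow> real^2) \<Rightarrow> bool" where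
  "planar_drawing G p c \<longleftrightarrow>
     inj_on p (verts G) \<and>
     (\<forall>e\<in>edges G. arc (c e) \<and> {pathstart (c e), pathfinish (c e)} = p ` ends G e \<and>
        path_image (c e) \<inter> p ` verts G = p ` ends G e) \<and>
     (\<forall>e\<in>edges G. \<forall>f\<in>edges G. e \<noteq> f \<longrightarrow>
        path_image (c e) \<inter> path_image (c f) = p ` (ends G e \<inter> ends G f))"

definition planar :: "('v, 'e) multigraph \<Rightarrow> bool" where
  "planar G \<longleftrightarrow> (\<exists>p c. planar_drawing G p c)"

definition induced :: "('v, 'e) multigraph \<Rightarrow> 'v set \<Rightarrow> ('v, 'e) multigraph" where
  "induced G S = \<lparr>verts = S, edges = {e \<in> edges G. ends G e \<subseteq> S}, ends = ends G\<rparr>"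

(* The edge es ! i joins vs ! i to its cyclic successor.  For length 2, distinctness of es makes
   this a pair of parallel edges. *)
definition is_cycle :: "('v, 'e) multigraph \<Rightarrow> 'v list \<Rightarrow> 'e list \<Rightarrow> bool" where
  "is_cycle G vs es \<longleftrightarrow>
     length vs \<ge> 2 \<and> length es = length vs \<and> distinct vs \<and> distinct es \<and>
     set vs \<subseteq> verts G \<and> set es \<subseteq> edges G \<and>
     (\<forall>i<length vs. ends G (es ! i) = {vs ! i, vs ! (Suc i mod length vs)})"

definition is_forest :: "('v, 'e) multigraph \<Rightarrow> bool" where
  "is_forest G \<longleftrightarrow> \<not> (\<exists>vs es. is_cycle G vs es)"

definition max_induced_forest :: "('v, 'e) multigraph \<Rightarrow> nat" where
  "max_induced_forest G = Max {card S | S. S \<subseteq> verts G \<and> is_forest (induced G S)}"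

end

theory Submission
  imports Defs
begin

text \<open>For every pair of vertices joined by parallel edges, keep one edge, subdivide a second one
  and delete the others. The result \<open>G\<close> is a simple planar graph on \<open>n + k\<close> vertices. An induced
  forest \<open>F\<close> of \<open>G\<close> misses a vertex of each of the \<open>k\<close> triangles so created. If both old vertices of
  a triangle lie in \<open>F\<close>, then the new one does not, and we drop one of the old ones; otherwise we drop
  the new one if it is there. This loses at most \<open>k\<close> vertices, and what is left spans no parallel
  edges, so it induces the same forest in \<open>M\<close> as in \<open>G\<close>.\<close>

section \<open>Cycles under injective maps, and largest induced forests\<close>

text \<open>Meant to be read contrapositively: if \<open>H\<close> is a forest, so is any
  \<open>G\<close> that embeds into it in this way. Forests are pulled back like this twice, once
  along a relabelling and once along the embedding of part of the multigraph into its
  subdivision.\<close>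

lemma is_cycle_map:
  assumes cyc: "is_cycle G vs es"
    and f: "inj_on f (verts G)" "f ` verts G \<subseteq> verts H"
    and g: "inj_on g (edges G)" "g ` edges G \<subseteq> edges H"
    and ends: "\<And>e. e \<in> edges G \<Longrightarrow> ends H (g e) = f ` ends G e"
  shows "is_cycle H (map f vs) (map g es)"
proof -
  note c = cyc[unfolded is_cycle_def]
  have "distinct (map f vs)" "distinct (map g es)"
    using c f(1) g(1) by (auto simp: distinct_map intro: inj_on_subset)
  moreover have "ends H (map g es ! i) = {map f vs ! i, map f vs ! (Suc i mod length vs)}"
    if i: "i < length vs" for i
  proof -
    have "es ! i \<in> edges G" using c i by (metis nth_mem subsetD)
    moreover have "Suc i mod length vs < length vs" using i by (intro mod_less_divisor) auto
    ultimately show ?thesis using c i ends by simp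
  qed
  moreover have "set (map f vs) \<subseteq> verts H" "set (map g es) \<subseteq> edges H"
    unfolding set_map using c f(2) g(2) by blast+
  ultimately show ?thesis using c unfolding is_cycle_def by simp
qed

lemma induced_sel [simp]:
  "verts (induced G S) = S" "edges (induced G S) = {e \<in> edges G. ends G e \<subseteq> S}"
  "ends (induced G S) = ends G"
  by (simp_all add: induced_def)

lemma max_induced_forest_ge:
  assumes "finite (verts G)" "S \<subseteq> verts G" "is_forest (induced G S)"
  shows "card S \<le> max_induced_forest G"
  unfolding max_induced_forest_def using assms by (intro Max_ge) auto

lemma max_induced_forest_attained:
  assumes "finite (verts G)"
  obtains S where "S \<subseteq> verts G" "is_forest (induced G S)" "card S = max_induced_forest G"
proof -
  let ?C = "{card S | S. S \<subseteq> verts G \<and> is_forest (induced G S)}"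
  have "is_forest (induced G {})" by (auto simp: is_forest_def is_cycle_def)
  then have "?C \<noteq> {}" by blast
  moreover have "finite ?C" using assms by auto
  ultimately have "Max ?C \<in> ?C" by (rule Max_in[rotated])
  then show ?thesis using that unfolding max_induced_forest_def by auto
qed

lemma is_multigraphD:
  assumes "is_multigraph G"
  shows "finite (verts G)" "finite (edges G)"
    "\<And>e. e \<in> edges G \<Longrightarrow> ends G e \<subseteq> verts G" "\<And>e. e \<in> edges G \<Longrightarrow> card (ends G e) = 2"
  using assms by (auto simp: is_multigraph_def)

lemma planar_drawingD:
  assumes "planar_drawing G p c"
  shows "inj_on p (verts G)" "\<And>e. e \<in> edges G \<Longrightarrow> arc (c e)"
    "\<And>e. e \<in> edges G \<Longrightarrow> {pathstart (c e), pathfinish (c e)} = p ` ends G e"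
    "\<And>e. e \<in> edges G \<Longrightarrow> path_image (c e) \<inter> p ` verts G = p ` ends G e"
    "\<And>e f. e \<in> edges G \<Longrightarrow> f \<in> edges G \<Longrightarrow> e \<noteq> f \<Longrightarrow>
       path_image (c e) \<inter> path_image (c f) = p ` (ends G e \<inter> ends G f)"
  using assms by (auto simp: planar_drawing_def)

section \<open>Relabelling a graph by natural numbers\<close>

text \<open>The lower bound is assumed for graphs over \<open>nat\<close> only, while subdivision
  produces sum types. Since \<open>G\<close> is finite, its vertices and edges can be numbered
  injectively. The drawing is carried over to the copy, and an optimal forest of the copy is pulled
  back.\<close>

lemma simple_planar_transfer:
  fixes G :: "('v, 'e) multigraph"
  assumes lower_bound: "\<And>H :: (nat, nat) multigraph. is_simple_graph H \<Longrightarrow> planar H \<Longrightarrow>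
      card (verts H) = m \<Longrightarrow> real (max_induced_forest H) \<ge> b"
    and simple: "is_simple_graph G" and planar: "planar G" and m: "card (verts G) = m"
  shows "real (max_induced_forest G) \<ge> b"
proof -
  have mg: "is_multigraph G" using simple by (simp add: is_simple_graph_def)
  note G = is_multigraphD[OF mg]
  obtain f :: "'v \<Rightarrow> nat" where f: "inj_on f (verts G)"
    using G(1) finite_imp_inj_to_nat_seg by metis
  obtain g :: "'e \<Rightarrow> nat" where g: "inj_on g (edges G)"
    using G(2) finite_imp_inj_to_nat_seg by metis
  let ?f' = "inv_into (verts G) f" and ?g' = "inv_into (edges G) g"
  define H where "H = \<lparr>verts = f ` verts G, edges = g ` edges G, ends = \<lambda>d. f ` ends G (?g' d)\<rparr>"
  have H_sel: "verts H = f ` verts G" "edges H = g ` edges G"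
    and H_ends: "\<And>e. e \<in> edges G \<Longrightarrow> ends H (g e) = f ` ends G e"
    by (simp_all add: H_def g)
  have inv_image: "?f' ` f ` X = X" if "X \<subseteq> verts G" for X
    using f that by (rule inv_into_image_cancel)
  have "is_multigraph H"
    unfolding is_multigraph_def using G H_ends
    by (auto simp: H_sel card_image inj_on_subset[OF f])
  moreover have "inj_on (ends H) (edges H)"
  proof (clarsimp simp: H_sel inj_on_def H_ends)
    fix d e assume d: "d \<in> edges G" and e: "e \<in> edges G" and eq: "f ` ends G d = f ` ends G e"
    have "ends G d = ends G e" using eq inv_image G(3) d e by metis
    then show "g d = g e" using simple d e by (auto simp: is_simple_graph_def inj_on_def)
  qed
  ultimately have simple_H: "is_simple_graph H" by (simp add: is_simple_graph_def)
  obtain p c where pc: "planar_drawing G p c" using planar by (auto simp: planar_def)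
  \<comment> \<open>The copy is drawn with the same points and the same arcs, looked up through the
    inverse relabellings.\<close>
  have "planar_drawing H (p \<circ> ?f') (c \<circ> ?g')"
  proof -
    have img: "(p \<circ> ?f') ` f ` X = p ` X" if "X \<subseteq> verts G" for X
      using inv_image[OF that] by (simp only: image_comp[symmetric])
    have "inj_on (p \<circ> ?f') (verts H)"
      using pc f unfolding H_sel planar_drawing_def
      by (intro comp_inj_on) (auto simp: inv_image inj_on_inv_into)
    moreover have "arc (c e) \<and> {pathstart (c e), pathfinish (c e)} = (p \<circ> ?f') ` ends H (g e) \<and>
        path_image (c e) \<inter> (p \<circ> ?f') ` verts H = (p \<circ> ?f') ` ends H (g e)"
      if e: "e \<in> edges G" for e
      unfolding H_sel H_ends[OF e] img[OF G(3)[OF e]] img[OF subset_refl]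
      using planar_drawingD(2-4)[OF pc e] by blast
    moreover have "path_image (c d) \<inter> path_image (c e) = (p \<circ> ?f') ` (ends H (g d) \<inter> ends H (g e))"
      if d: "d \<in> edges G" and e: "e \<in> edges G" and "g d \<noteq> g e" for d e
    proof -
      have ne: "d \<noteq> e" using that by blast
      have "ends G d \<inter> ends G e \<subseteq> verts G" using G(3)[OF d] by blast
      then show ?thesis
        unfolding H_ends[OF d] H_ends[OF e] inj_on_image_Int[OF f G(3)[OF d] G(3)[OF e], symmetric]
        by (simp only: img planar_drawingD(5)[OF pc d e ne])
    qed
    moreover have "(c \<circ> ?g') (g e) = c e" if "e \<in> edges G" for e using g that by simp
    ultimately show ?thesis
      unfolding planar_drawing_def H_sel by (simp del: comp_apply image_comp)
  qed
  then have "planar H" by (auto simp: planar_def)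
  moreover have "card (verts H) = m" using m f by (simp add: H_sel card_image)
  ultimately have b: "b \<le> real (max_induced_forest H)" using lower_bound simple_H by blast
  have "finite (verts H)" using G(1) by (simp add: H_sel)
  then obtain S where S: "S \<subseteq> verts H" "is_forest (induced H S)" "card S = max_induced_forest H"
    by (rule max_induced_forest_attained)
  then obtain T where T: "T \<subseteq> verts G" "S = f ` T" unfolding H_sel by (meson subset_imageE)
  have "is_forest (induced G T)"
    unfolding is_forest_def
  proof
    assume "\<exists>vs es. is_cycle (induced G T) vs es"
    then obtain vs es where "is_cycle (induced G T) vs es" by blast
    then have "is_cycle (induced H S) (map f vs) (map g es)"
    proof (rule is_cycle_map)
      show "inj_on f (verts (induced G T))" using f T by (simp add: inj_on_subset)
      show "inj_on g (edges (induced G T))" using g by (auto intro: inj_on_subset)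
      show "g ` edges (induced G T) \<subseteq> edges (induced H S)"
        using T H_ends by (fastforce simp: H_sel)
    qed (use T H_ends in auto)
    then show False using S(2) by (auto simp: is_forest_def)
  qed
  then have "card T \<le> max_induced_forest G" using T G(1) by (intro max_induced_forest_ge)
  moreover have "card T = card S" using T f by (simp add: card_image inj_on_subset)
  ultimately show ?thesis using b S(3) by simp
qed

section \<open>Subdivision of edges: planarity and simplicity\<close>

text \<open>The edge \<open>e \<in> B\<close> with ends \<open>x e False\<close> and \<open>x e True\<close> is replaced by the path through the new
  vertex \<open>Inr e\<close>, whose edge at \<open>x e i\<close> is \<open>Inr (e, i)\<close>.\<close>

definition subdivide ::
  "('v, 'e) multigraph \<Rightarrow> 'e set \<Rightarrow> ('e \<Rightarrow> bool \<Rightarrow> 'v) \<Rightarrow> ('v + 'e, 'e + 'e \<times> bool) multigraph" where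
  "subdivide G B x =
     \<lparr>verts = Inl ` verts G \<union> Inr ` B,
      edges = Inl ` (edges G - B) \<union> Inr ` (B \<times> UNIV),
      ends = (\<lambda>d. case d of Inl e \<Rightarrow> Inl ` ends G e | Inr (e, i) \<Rightarrow> {Inl (x e i), Inr e})\<rparr>"

lemma subdivide_sel [simp]:
  "verts (subdivide G B x) = Inl ` verts G \<union> Inr ` B"
  "edges (subdivide G B x) = Inl ` (edges G - B) \<union> Inr ` (B \<times> UNIV)"
  "ends (subdivide G B x) (Inl e) = Inl ` ends G e"
  "ends (subdivide G B x) (Inr (e, i)) = {Inl (x e i), Inr e}"
  by (simp_all add: subdivide_def)

text \<open>The arc of each \<open>e\<close> in \<open>B\<close> is cut at parameter
  \<open>1/2\<close>, and that point becomes the new vertex. Injectivity of the arc makes the two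
  halves meet only there, and every other arc avoids the point because distinct arcs meet only in
  vertices.\<close>

lemma planar_subdivide:
  assumes G: "is_multigraph G" and pc: "planar_drawing G p c" and B: "B \<subseteq> edges G"
    and x: "\<And>e. e \<in> B \<Longrightarrow> ends G e = {x e False, x e True}"
    and start: "\<And>e. e \<in> B \<Longrightarrow> pathstart (c e) = p (x e False)"
    and finish: "\<And>e. e \<in> B \<Longrightarrow> pathfinish (c e) = p (x e True)"
  shows "planar (subdivide G B x)"
proof -
  note G = is_multigraphD[OF G] and D = planar_drawingD[OF pc]
  let ?H = "subdivide G B x" and ?mid = "\<lambda>e. c e (1/2)"
  \<comment> \<open>Both halves run towards the midpoint: \<open>half e True\<close> traverses its
    part of the arc backwards, so that \<open>half e i\<close> always starts at
    \<open>x e i\<close>.\<close>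
  define half where "half e i = subpath (if i then 1 else 0) (1/2) (c e)" for e i
  define q where "q = case_sum p ?mid"
  define h where "h = case_sum c (\<lambda>(e, i). half e i)"
  \<comment> \<open>\<open>base\<close> gives the original edge from which an edge of
    \<open>?H\<close> stems, and \<open>old\<close> gives the ends of that edge of \<open>?H\<close>
    among the original vertices.\<close>
  define base where "base = case_sum (\<lambda>e. e) (fst :: 'b \<times> bool \<Rightarrow> 'b)"
  define old where "old d = {v. Inl v \<in> ends ?H d}" for d
  have q_simps [simp]: "q (Inl v) = p v" "q (Inr e) = ?mid e" for v e by (simp_all add: q_def)
  have h_simps [simp]: "h (Inl e) = c e" "h (Inr (e, i)) = half e i" for e i
    by (simp_all add: h_def)
  have base_simps [simp]: "base (Inl e) = e" "base (Inr (e, i)) = e" for e i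
    by (simp_all add: base_def)
  have inj_c: "inj_on (c e) {0..1}" if "e \<in> edges G" for e
    using D(2)[OF that] by (simp add: arc_def)
  have xV: "x e i \<in> verts G" if "e \<in> B" for e i
    using G(3)[of e] B x[OF that] that by (cases i) auto
  have half_image: "path_image (half e i) = c e ` (if i then {1/2..1} else {0..1/2})" for e i
    by (simp add: half_def path_image_subpath_gen closed_segment_eq_real_ivl)
  have half_sub: "path_image (half e i) \<subseteq> path_image (c e)" for e i
    unfolding half_image by (auto simp: path_image_def)
  have start': "c e 0 = p (x e False)" and finish': "c e 1 = p (x e True)" if "e \<in> B" for e
    using start[OF that] finish[OF that] by (simp_all add: pathstart_def pathfinish_def)
  have mid_in: "?mid e \<in> path_image (c e)" for e by (simp add: path_image_def)
  \<comment> \<open>The arc passes through vertices only at its two ends, with parameters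
    \<open>0\<close> and \<open>1\<close>; injectivity keeps the parameter \<open>1/2\<close> away
    from both.\<close>
  have mid_old: "?mid e \<notin> p ` verts G" if "e \<in> B" for e
  proof
    assume "?mid e \<in> p ` verts G"
    then have "?mid e \<in> p ` ends G e" using D(4)[of e] mid_in B that by blast
    then have "?mid e = c e 0 \<or> ?mid e = c e 1" using x that start' finish' by auto
    moreover have "inj_on (c e) {0..1}" using inj_c B that by blast
    ultimately show False by (auto dest: inj_onD)
  qed
  have mid_other: "?mid e \<notin> path_image (c d)" if "e \<in> B" "d \<in> edges G" "d \<noteq> e" for d e
  proof
    assume "?mid e \<in> path_image (c d)"
    then have "?mid e \<in> p ` (ends G e \<inter> ends G d)" using D(5)[of e d] mid_in B that by blast
    then show False using mid_old[OF that(1)] G(3)[OF that(2)] by blast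
  qed
  \<comment> \<open>By injectivity of the arc, the intersection can be computed on parameters, where
    each half interval contains exactly one of \<open>0\<close> and \<open>1\<close>.\<close>
  have half_old: "path_image (half e i) \<inter> p ` verts G = {p (x e i)}" if e: "e \<in> B" for e i
  proof -
    have inj: "inj_on (c e) {0..1}" using inj_c B e by blast
    have "path_image (half e i) \<inter> p ` verts G = path_image (half e i) \<inter> p ` ends G e"
      using half_sub[of e i] D(4)[of e] B e G(3)[of e] by blast
    also have "p ` ends G e = c e ` {0, 1}" using x start' finish' e by simp
    also have "path_image (half e i) \<inter> c e ` {0, 1} =
        c e ` ((if i then {1/2..1} else {0..1/2}) \<inter> {0, 1})"
      unfolding half_image by (rule inj_on_image_Int[OF inj, symmetric]) auto
    also have "(if i then {1/2..1} else {0..1/2}) \<inter> {0, 1} = {if i then 1 else 0 :: real}" by auto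
    finally show ?thesis using start' finish' e by simp
  qed
  have half_half: "path_image (half e False) \<inter> path_image (half e True) = {?mid e}"
    if e: "e \<in> B" for e
  proof -
    have inj: "inj_on (c e) {0..1}" using inj_c B e by blast
    have "path_image (half e False) \<inter> path_image (half e True) = c e ` ({0..1/2} \<inter> {1/2..1})"
      unfolding half_image if_True if_False
      by (rule inj_on_image_Int[OF inj, symmetric]) auto
    also have "{0..1/2} \<inter> {1/2..1} = {1/2 :: real}" by auto
    finally show ?thesis by simp
  qed
  have old_simps: "old (Inl e) = ends G e" "old (Inr (e, i)) = {x e i}" for e i
    by (auto simp: old_def)
  have base_edge: "base d \<in> edges G" if "d \<in> edges ?H" for d using that B by auto
  have h_sub: "path_image (h d) \<subseteq> path_image (c (base d))" for d
    using half_sub[THEN subsetD] by (cases d) auto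
  have h_old: "path_image (h d) \<inter> p ` verts G = p ` old d" if "d \<in> edges ?H" for d
    using that unfolding subdivide_sel
    by (elim UnE imageE SigmaE) (simp_all add: D(4) half_old old_simps)
  have old_sub: "old d \<subseteq> verts G" if "d \<in> edges ?H" for d
    using that subsetD[OF G(3)] xV by (cases d) (auto simp: old_simps)
  have "inj_on q (verts ?H)"
  proof (rule inj_onI)
    fix u v assume uv: "u \<in> verts ?H" "v \<in> verts ?H" and eq: "q u = q v"
    have mid_inj: "?mid d = ?mid e \<longleftrightarrow> d = e" if "d \<in> B" "e \<in> B" for d e
      using mid_other mid_in that B by (metis subsetD)
    have mid_ne: "?mid e \<noteq> p w" "p w \<noteq> ?mid e" if "e \<in> B" "w \<in> verts G" for e w
      using mid_old[OF that(1)] that(2) by (metis imageI)+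
    show "u = v"
      using uv eq by (cases u; cases v) (auto simp: mid_inj mid_ne inj_on_eq_iff[OF D(1)])
  qed
  moreover have "arc (h d) \<and> {pathstart (h d), pathfinish (h d)} = q ` ends ?H d \<and>
      path_image (h d) \<inter> q ` verts ?H = q ` ends ?H d" if d: "d \<in> edges ?H" for d
  proof (cases d)
    case (Inl e)
    then have e: "e \<in> edges G" "e \<notin> B" using d by auto
    have "path_image (c e) \<inter> ?mid ` B = {}" using mid_other e by blast
    then show ?thesis using e D(2-4)[OF e(1)] Inl
      by (simp add: image_Un image_image Int_Un_distrib)
  next
    case (Inr y)
    obtain i e where y: "y = (e, i)" by (cases y)
    have e: "e \<in> B" "e \<in> edges G" using d Inr y B by auto
    have "arc (half e i)"
      unfolding half_def using D(2)[OF e(2)] by (intro arc_subpath_arc) auto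
    moreover have "pathstart (half e i) = p (x e i)" "pathfinish (half e i) = ?mid e"
      using start' finish' e by (simp_all add: half_def)
    moreover have "path_image (half e i) \<inter> ?mid ` B = {?mid e}"
    proof -
      have "?mid e \<in> path_image (half e i)" unfolding half_image by auto
      then show ?thesis using mid_other half_sub[of e i] e by blast
    qed
    ultimately show ?thesis using half_old[OF e(1), of i] Inr y
      by (simp add: image_Un image_image Int_Un_distrib insert_commute)
  qed
  moreover have "path_image (h d) \<inter> path_image (h d') = q ` (ends ?H d \<inter> ends ?H d')"
    if d: "d \<in> edges ?H" and d': "d' \<in> edges ?H" and ne: "d \<noteq> d'" for d d'
  \<comment> \<open>Distinct edges with a common base are the two halves of one arc. With different
    bases, the underlying arcs meet only in original vertices, so \<open>old\<close> determines the
    intersection.\<close>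
  proof (cases "base d = base d'")
    case True
    then have "\<exists>e i j. e \<in> B \<and> d = Inr (e, i) \<and> d' = Inr (e, j)"
      using d d' ne by auto
    then obtain e i j where e: "e \<in> B" "d = Inr (e, i)" "d' = Inr (e, j)" by blast
    moreover from this have "j \<longleftrightarrow> \<not> i" using ne by auto
    moreover have "x e False \<noteq> x e True" using G(4)[of e] x B e by (auto simp: card_insert_if)
    ultimately show ?thesis using half_half[OF e(1)] by (cases i) (auto simp: Int_commute)
  next
    case False
    have "path_image (c (base d)) \<inter> path_image (c (base d')) \<subseteq> p ` verts G"
      using D(5)[OF base_edge[OF d] base_edge[OF d'] False] G(3)[OF base_edge[OF d]] by auto
    then have "path_image (h d) \<inter> path_image (h d') =
        (path_image (h d) \<inter> p ` verts G) \<inter> (path_image (h d') \<inter> p ` verts G)"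
      using h_sub[of d] h_sub[of d'] by blast
    also have "\<dots> = p ` (old d \<inter> old d')"
      by (simp only: h_old[OF d] h_old[OF d'] inj_on_image_Int[OF D(1) old_sub[OF d] old_sub[OF d']])
    also have "\<dots> = q ` Inl ` (old d \<inter> old d')" by (simp add: image_image)
    \<comment> \<open>No new vertex is shared here: \<open>Inr e\<close> is an end only of edges
      with base \<open>e\<close>.\<close>
    also have "Inl ` (old d \<inter> old d') = ends ?H d \<inter> ends ?H d'"
      using d d' False by (auto simp: old_def)
    finally show ?thesis .
  qed
  ultimately have "planar_drawing ?H q h" by (simp only: planar_drawing_def) blast
  then show ?thesis by (auto simp: planar_def)
qed

lemma planar_drawing_delete_edges:
  assumes "planar_drawing G p c" "E \<subseteq> edges G"
  shows "planar_drawing (G\<lparr>edges := E\<rparr>) p c"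
  using assms by (simp add: planar_drawing_def subset_iff)

text \<open>A half edge is determined by its new vertex together with its old end, since an edge of
  \<open>G\<close> has two different ends. The edges left whole are told apart by
  \<open>inj\<close>, and they contain no new vertex.\<close>

lemma simple_subdivide:
  assumes G: "is_multigraph G" and B: "B \<subseteq> edges G"
    and inj: "inj_on (ends G) (edges G - B)"
    and x: "\<And>e. e \<in> B \<Longrightarrow> ends G e = {x e False, x e True}"
  shows "is_simple_graph (subdivide G B x)"
proof -
  note G = is_multigraphD[OF G]
  have xV: "x e i \<in> verts G" if "e \<in> B" for e i
    using G(3)[of e] B x[OF that] that by (cases i) auto
  have x_ne: "x e False \<noteq> x e True" if "e \<in> B" for e
    using G(4)[of e] x B that by (auto simp: card_insert_if)
  have "is_multigraph (subdivide G B x)"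
    unfolding is_multigraph_def using G(1,2,4) B xV subsetD[OF G(3)]
    by (auto simp: card_image finite_subset image_iff)
  moreover have "inj_on (ends (subdivide G B x)) (edges (subdivide G B x))"
  proof (rule inj_onI)
    fix d d' assume d: "d \<in> edges (subdivide G B x)" "d' \<in> edges (subdivide G B x)"
      and eq: "ends (subdivide G B x) d = ends (subdivide G B x) d'"
    have halves: "x e i = x e j \<longleftrightarrow> i = j" if "e \<in> B" for e i j
      using x_ne[OF that] by (cases i; cases j) auto
    show "d = d'"
      using d eq inj halves
      by (cases d; cases d') (auto simp: inj_on_def inj_image_eq_iff doubleton_eq_iff)
  qed
  ultimately show ?thesis by (simp add: is_simple_graph_def)
qed

section \<open>Choosing edges from the parallel classes\<close>

lemma ex_transversal:
  obtains A where "A \<subseteq> E" "inj_on f A" "f ` A = f ` E"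
  by (metis subset_image_inj order_refl)

lemma parallel_pairsI:
  "e \<in> edges G \<Longrightarrow> d \<in> edges G \<Longrightarrow> e \<noteq> d \<Longrightarrow> ends G e = ends G d \<Longrightarrow> ends G e \<in> parallel_pairs G"
  unfolding parallel_pairs_def by (intro CollectI bexI[of _ e] bexI[of _ d]) simp_all

text \<open>\<open>A\<close> takes one edge from every class of parallel edges. An edge left over is
  parallel to one in \<open>A\<close>, so the leftover edges span exactly the parallel pairs, and
  \<open>B\<close> takes one of them for each pair.\<close>

lemma parallel_edges_representatives:
  obtains A B where "A \<subseteq> edges G" "B \<subseteq> edges G - A" "inj_on (ends G) A"
    "inj_on (ends G) B" "ends G ` A = ends G ` edges G" "ends G ` B = parallel_pairs G"
proof -
  obtain A where A: "A \<subseteq> edges G" "inj_on (ends G) A" "ends G ` A = ends G ` edges G"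
    by (rule ex_transversal)
  obtain B where B: "B \<subseteq> edges G - A" "inj_on (ends G) B"
    "ends G ` B = ends G ` (edges G - A)"
    by (rule ex_transversal)
  have "ends G ` (edges G - A) = parallel_pairs G"
  proof (intro equalityI subsetI)
    fix P assume "P \<in> ends G ` (edges G - A)"
    then obtain e where e: "e \<in> edges G" "e \<notin> A" "ends G e = P" by blast
    then obtain d where "d \<in> A" "ends G d = P" using A(3) by (metis imageE imageI)
    then show "P \<in> parallel_pairs G" using e A(1) parallel_pairsI[of e G d] by auto
  next
    fix P assume "P \<in> parallel_pairs G"
    then obtain e d where "e \<in> edges G" "d \<in> edges G" "e \<noteq> d" "ends G e = P" "ends G d = P"
      by (auto simp: parallel_pairs_def)
    \<comment> \<open>As \<open>A\<close> contains at most one edge of each class, one of two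
      parallel edges lies outside it.\<close>
    moreover from this have "e \<notin> A \<or> d \<notin> A" using A(2) by (metis inj_onD)
    ultimately show "P \<in> ends G ` (edges G - A)" by blast
  qed
  then show ?thesis using that A B by metis
qed

section \<open>Comparing induced forests before and after subdivision\<close>

text \<open>Passing from an optimal forest \<open>F\<close> of \<open>?H\<close> to \<open>S\<close>
  loses the new vertices, counted by \<open>R\<close>, and at most one old vertex for each edge in
  \<open>D\<close>. The sets \<open>D\<close> and \<open>R\<close> are disjoint subsets of
  \<open>B\<close>, so the total loss is at most \<open>card B\<close>.\<close>

lemma max_induced_forest_subdivide:
  assumes M: "is_multigraph M"
    and A: "A \<subseteq> edges M" "ends M ` A = ends M ` edges M"
    and B: "B \<subseteq> edges M - A" "ends M ` B = parallel_pairs M"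
    and x: "\<And>e. e \<in> B \<Longrightarrow> ends M e = {x e False, x e True}"
  shows "max_induced_forest (subdivide (M\<lparr>edges := A \<union> B\<rparr>) B x) \<le> max_induced_forest M + card B"
proof -
  note G = is_multigraphD[OF M]
  let ?H = "subdivide (M\<lparr>edges := A \<union> B\<rparr>) B x"
  have finB: "finite B" using B(1) G(2) by (auto intro: finite_subset)
  have AB: "A \<union> B - B = A" using B(1) by blast
  have "finite (verts ?H)" using G(1) finB by simp
  then obtain F where F: "F \<subseteq> verts ?H" "is_forest (induced ?H F)"
    "card F = max_induced_forest ?H"
    by (rule max_induced_forest_attained)
  define T where "T = {v. Inl v \<in> F}"
  define R where "R = {e. Inr e \<in> F}"
  define D where "D = {e \<in> B. ends M e \<subseteq> T}"
  \<comment> \<open>Of the two ends of an edge in \<open>D\<close>, the one labelled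
    \<open>True\<close> is dropped; this choice is arbitrary.\<close>
  define S where "S = T - (\<lambda>e. x e True) ` D"
  have F_eq: "F = Inl ` T \<union> Inr ` R"
    by (auto simp: T_def R_def image_iff) (metis sum.exhaust)
  have T: "T \<subseteq> verts M" and R: "R \<subseteq> B" using F(1) by (auto simp: T_def R_def)
  have fin: "finite T" "finite R" "finite D"
    using T R G(1) finB by (auto intro: finite_subset simp: D_def)
  have "D \<inter> R = {}"
  proof (rule ccontr)
    assume "D \<inter> R \<noteq> {}"
    then obtain e where e: "e \<in> B" "ends M e \<subseteq> T" "e \<in> R" by (auto simp: D_def)
    \<comment> \<open>\<open>A\<close> meets every parallel class, so some unsubdivided edge
      \<open>d\<close> joins the ends of \<open>e\<close>. It closes the triangle through
      \<open>Inr e\<close>.\<close>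
    then have "ends M e \<in> ends M ` A" using A(2) B(1) by blast
    then obtain d where d: "d \<in> A" "ends M d = ends M e" by auto
    have ne: "x e False \<noteq> x e True" using G(4)[of e] x B(1) e(1) by (auto simp: card_insert_if)
    have in_F: "Inl (x e False) \<in> F" "Inl (x e True) \<in> F" "Inr e \<in> F"
      using e x[OF e(1)] by (auto simp: T_def R_def)
    have "is_cycle (induced ?H F) [Inl (x e False), Inl (x e True), Inr e]
        [Inl d, Inr (e, True), Inr (e, False)]"
      using ne in_F d e(1) x[OF e(1)] B(1)
      by (auto simp: is_cycle_def All_less_Suc)
    then show False using F(2) by (auto simp: is_forest_def)
  qed
  then have "card D + card R \<le> card B"
    using card_mono[OF finB, of "D \<union> R"] R fin by (simp add: D_def card_Un_disjoint)
  moreover have "card F = card T + card R"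
    unfolding F_eq using fin by (subst card_Un_disjoint) (auto simp: card_image)
  \<comment> \<open>Only an inequality holds in general, since different edges in \<open>D\<close>
    may share their dropped vertex.\<close>
  moreover have "card T - card D \<le> card S"
    unfolding S_def using diff_card_le_card_Diff[of "(\<lambda>e. x e True) ` D" T] fin
      card_image_le[OF fin(3), of "\<lambda>e. x e True"] by simp
  moreover have "is_forest (induced M S)"
    unfolding is_forest_def
  proof
    assume "\<exists>vs es. is_cycle (induced M S) vs es"
    then obtain vs es where cyc: "is_cycle (induced M S) vs es" by blast
    \<comment> \<open>An edge outside \<open>A\<close> joins a parallel pair, which has a
      representative \<open>b\<close> in \<open>B\<close>. If both ends lay in \<open>S\<close>,
      then \<open>b\<close> would be in \<open>D\<close> and its end \<open>x b True\<close> would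
      have been dropped. Hence \<open>S\<close> spans only edges of \<open>A\<close>, and these
      survive whole in \<open>?H\<close>.\<close>
    have in_A: "e \<in> A" if e: "e \<in> edges M" "ends M e \<subseteq> S" for e
    proof (rule ccontr)
      assume "e \<notin> A"
      obtain d where "d \<in> A" "ends M d = ends M e" using A(2) e(1) by (metis imageE imageI)
      then have "ends M e \<in> parallel_pairs M"
        using \<open>e \<notin> A\<close> e(1) A(1) parallel_pairsI[of e M d] by auto
      then obtain b where b: "b \<in> B" "ends M b = ends M e" using B(2) by (metis imageE)
      then have "b \<in> D" using e(2) by (auto simp: D_def S_def)
      then show False using b x[OF b(1)] e(2) by (auto simp: S_def)
    qed
    from cyc have "is_cycle (induced ?H F) (map Inl vs) (map Inl es)"
    proof (rule is_cycle_map)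
      show "Inl ` verts (induced M S) \<subseteq> verts (induced ?H F)" by (auto simp: S_def T_def)
      show "Inl ` edges (induced M S) \<subseteq> edges (induced ?H F)"
        using in_A by (auto simp: AB S_def T_def)
    qed auto
    then show False using F(2) by (auto simp: is_forest_def)
  qed
  then have "card S \<le> max_induced_forest M"
    using G(1) T by (intro max_induced_forest_ge) (auto simp: S_def)
  ultimately show ?thesis using F(3) by linarith
qed

section \<open>Applying the simple planar bound to the subdivided multigraph\<close>

theorem theorem8:
  fixes a :: "nat \<Rightarrow> real" and M :: "('v, 'e) multigraph" and n k :: nat
  assumes lower_bound: "\<And>(G :: (nat, nat) multigraph) m.
      is_simple_graph G \<Longrightarrow> planar G \<Longrightarrow> card (verts G) = m \<Longrightarrow>
      real (max_induced_forest G) \<ge> a m"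
    and "is_multigraph M" and "planar M"
    and "card (verts M) = n" and "card (parallel_pairs M) = k"
  shows "real (max_induced_forest M) \<ge> a (n + k) - real k"
proof -
  note G = is_multigraphD[OF assms(2)]
  obtain p c where pc: "planar_drawing M p c" using assms(3) by (auto simp: planar_def)
  obtain A B where A: "A \<subseteq> edges M" "inj_on (ends M) A" "ends M ` A = ends M ` edges M"
    and B: "B \<subseteq> edges M - A" "inj_on (ends M) B" "ends M ` B = parallel_pairs M"
    using parallel_edges_representatives[of M] by metis
  have cardB: "card B = k" using card_image[OF B(2)] B(3) assms(5) by simp
  have finB: "finite B" using B(1) G(2) by (auto intro: finite_subset)
  \<comment> \<open>The ends of an edge are labelled by the direction of its arc:
    \<open>False\<close> is the vertex where the arc starts and \<open>True\<close> the one where it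
    finishes, recovered from the points by inverting \<open>p\<close>.\<close>
  define x where
    "x e i = inv_into (verts M) p (if i then pathfinish (c e) else pathstart (c e))" for e i
  have p_x: "pathstart (c e) = p (x e False)" "pathfinish (c e) = p (x e True)"
    if "e \<in> B" for e
  proof -
    have "{pathstart (c e), pathfinish (c e)} \<subseteq> p ` verts M"
      using planar_drawingD(3)[OF pc, of e] G(3)[of e] B(1) that by blast
    then show "pathstart (c e) = p (x e False)" "pathfinish (c e) = p (x e True)"
      by (simp_all add: x_def f_inv_into_f)
  qed
  have x: "ends M e = {x e False, x e True}" if "e \<in> B" for e
  proof -
    have e: "e \<in> edges M" using B(1) that by blast
    have "ends M e = inv_into (verts M) p ` p ` ends M e"
      using inv_into_image_cancel[OF planar_drawingD(1)[OF pc] G(3)[OF e]] by simp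
    also have "\<dots> = {x e False, x e True}"
      by (simp add: planar_drawingD(3)[OF pc e, symmetric] x_def)
    finally show ?thesis .
  qed
  \<comment> \<open>Once \<open>B\<close> is subdivided, the whole edges of \<open>?N\<close> are
    those of \<open>A\<close>, which are pairwise non-parallel; this yields simplicity.\<close>
  let ?N = "M\<lparr>edges := A \<union> B\<rparr>"
  have AB: "A \<union> B - B = A" "A \<union> B \<subseteq> edges M" using A(1) B(1) by auto
  have N: "is_multigraph ?N"
    using assms(2) AB(2) by (auto simp: is_multigraph_def finite_subset)
  have pl: "planar (subdivide ?N B x)"
    using planar_subdivide[OF N planar_drawing_delete_edges[OF pc AB(2)]] x p_x by simp
  have si: "is_simple_graph (subdivide ?N B x)"
    using simple_subdivide[OF N] A(2) x by (simp add: AB(1))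
  have ca: "card (verts (subdivide ?N B x)) = n + k"
    using G(1) finB cardB assms(4)
    unfolding subdivide_sel by (subst card_Un_disjoint) (auto simp: card_image)
  have "a (n + k) \<le> real (max_induced_forest (subdivide ?N B x))"
    by (rule simple_planar_transfer[OF _ si pl ca]) (rule lower_bound)
  also have "\<dots> \<le> real (max_induced_forest M + k)"
    using max_induced_forest_subdivide[OF assms(2) A(1,3) B(1,3)] x cardB by (simp only: of_nat_le_iff)
  finally show ?thesis by simp
qed

end
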